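(* Let $q_0\ge 2$ be even, let $s\ge 2$ and $q=q_0^s$. Then $\rho(C_s(q_0))=3$ if and only if there exists $\alpha\in\mathbb{F}_q\setminus\mathbb{F}_{q_0}$ such that (1) $\mathrm{Tr}_{\mathbb{F}_q/\mathbb{F}_{q_0}}(\alpha)=0$, and (2) $\mathrm{Tr}_{\mathbb{F}_q/\mathbb{F}_{q_0}}\left(\frac{1}{1+b\alpha}\right)\in\{0,1\}$ for all $b\in\mathbb{F}_{q_0}^*$. Otherwise $\rho(C_s(q_0))=2$.
   Context: Let $q_0$ be a prime power, $s\ge1$, $q=q_0^s$, and $H=\{x\in\mathbb{F}_{q^2}: x^{q+1}=1\}$. The code $C_s(q_0)$ is the linear code of length $q+1$ over $\mathbb{F}_{q_0}$ with coordinates indexed by $H$: $C_s(q_0)=\{(c_x)_{x\in H}\in\mathbb{F}_{q_0}^{q+1}: \sum_{x\in H}c_x x=0\}$. $\rho(C)$ denotes the covering radius of a code $C$ (maximum over all vectors of the minimum Hamming distance to the code). $\mathrm{Tr}_{\mathbb{F}_q/\mathbb{F}_{q_0}}(y)=\sum_{i=0}^{s-1}y^{q_0^i}$ is the relative trace. *)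

theory Defs
  imports "HOL-Number_Theory.Prime_Powers" "HOL-Library.FuncSet" "HOL-Library.Cardinality"
begin

definition is_subfield :: "'a::field set \<Rightarrow> bool" where
  "is_subfield K \<longleftrightarrow> 0 \<in> K \<and> 1 \<in> K \<and>
     (\<forall>x\<in>K. \<forall>y\<in>K. x + y \<in> K \<and> x * y \<in> K) \<and>
     (\<forall>x\<in>K. - x \<in> K \<and> inverse x \<in> K)"

text \<open>
  Vectors over an alphabet \<open>A\<close> with coordinates indexed by \<open>I\<close> are the extensional
  functions \<open>I \<rightarrow>\<^sub>E A\<close>. The \<open>MAX\<close> and \<open>MIN\<close> below are meaningful only for finite \<open>I\<close> and
  \<open>A\<close>, with \<open>A\<close> and \<open>C\<close> nonempty.
\<close>

definition hamming_dist :: "'i set \<Rightarrow> ('i \<Rightarrow> 'a) \<Rightarrow> ('i \<Rightarrow> 'a) \<Rightarrow> nat" where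
  "hamming_dist I u v = card {i \<in> I. u i \<noteq> v i}"

definition covering_radius :: "'i set \<Rightarrow> 'a set \<Rightarrow> ('i \<Rightarrow> 'a) set \<Rightarrow> nat" where
  "covering_radius I A C = (MAX v\<in>I \<rightarrow>\<^sub>E A. MIN c\<in>C. hamming_dist I v c)"

text \<open>
  In the following, the ambient type \<open>'a\<close> plays the role of the field with \<open>q\<^sup>2\<close> elements
  and \<open>K\<close> that of its subfield with \<open>q\<^sub>0\<close> elements.
\<close>

definition norm_one_group :: "nat \<Rightarrow> 'a::field set" where
  "norm_one_group q = {x. x ^ (q + 1) = 1}"

definition code_C :: "'a::field set \<Rightarrow> nat \<Rightarrow> ('a \<Rightarrow> 'a) set" where
  "code_C K q = {c \<in> norm_one_group q \<rightarrow>\<^sub>E K. (\<Sum>x\<in>norm_one_group q. c x * x) = 0}"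

definition rel_trace :: "nat \<Rightarrow> nat \<Rightarrow> 'a::field \<Rightarrow> 'a" where
  "rel_trace q0 s y = (\<Sum>i<s. y ^ (q0 ^ i))"

end

theory Submission
  imports Defs "HOL-Computational_Algebra.Polynomial"
begin

text \<open>
  The covering radius is the least \<open>n\<close> such that every field element is a combination of \<open>n\<close>
  elements of \<open>H\<close> with coefficients in \<open>K\<close>. By polar decomposition it suffices to represent
  \<open>t \<in> L\<close>, and elements of \<open>L - K\<close> need at least two terms. The key fact is that \<open>y \<in> L\<close> has
  absolute trace \<open>1\<close> iff \<open>1 / y = x + x\<^sup>-\<^sup>1\<close> for some \<open>x \<in> H - {1}\<close>. Taking norms in
  \<open>t + a x = b y\<close>, it shows that \<open>t\<close> is a sum of two terms iff \<open>a t / (t + c)\<^sup>2\<close> has absolute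
  trace \<open>1\<close> for some \<open>a, c \<in> K\<close>, where \<open>c = a + b\<close>; transitivity of the trace removes \<open>a\<close>, and \<open>\<alpha> = 1 / t\<close>
  gives the stated condition. Three terms always suffice: \<open>t = x + h y + h y\<^sup>-\<^sup>1\<close> can be solved
  once \<open>w\<close> and \<open>k / w\<close> can be given prescribed absolute traces, for a certain \<open>k\<close> depending on \<open>t\<close>.
\<close>

section \<open>Finite fields: subfields as root sets, and bounds from counting roots\<close>

lemma subfield_power_card:
  fixes S :: "'a::field set"
  assumes S: "is_subfield S" "finite S" and x: "x \<in> S"
  shows "x ^ card S = x"
proof (cases "x = 0")
  case True
  then show ?thesis using S x by (simp add: card_gt_0_iff) blast
next
  case False
  let ?U = "S - {0}"
  have 0: "0 \<in> S" using S by (simp add: is_subfield_def)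
  have cl: "a * b \<in> S" "inverse a \<in> S" if "a \<in> S" "b \<in> S" for a b
    using S that by (simp_all add: is_subfield_def)
  \<comment> \<open>Multiplication by \<open>x\<close> permutes \<open>?U\<close>, so the product
    over \<open>?U\<close> is unchanged by the factor \<open>x ^ card ?U\<close>; cancelling it
    leaves \<open>x ^ card ?U = 1\<close>.\<close>
  have "bij_betw (\<lambda>y. x * y) ?U ?U"
    by (rule bij_betw_byWitness[where f' = "\<lambda>y. inverse x * y"])
       (use False x cl in auto)
  then have "(\<Prod>y\<in>?U. x * y) = (\<Prod>y\<in>?U. y)"
    by (rule prod.reindex_bij_betw)
  then have "x ^ card ?U * (\<Prod>y\<in>?U. y) = (\<Prod>y\<in>?U. y)"
    by (simp add: prod.distrib)
  moreover have "(\<Prod>y\<in>?U. y) \<noteq> 0" using S by simp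
  ultimately have "x ^ card ?U = 1" by simp
  moreover have "card S = Suc (card ?U)" using 0 S by (metis card.remove)
  ultimately show ?thesis by simp
qed

text \<open>Used as a lower bound for \<open>card B\<close>: small fibres force a large
  target.\<close>

lemma card_le_fibre_bound:
  assumes "finite A" "finite B" "f ` A \<subseteq> B"
    and "\<And>b. b \<in> B \<Longrightarrow> card {a \<in> A. f a = b} \<le> n"
  shows "card A \<le> n * card B"
proof -
  have "A = (\<Union>b\<in>B. {a \<in> A. f a = b})" using assms(3) by blast
  then have "card A \<le> (\<Sum>b\<in>B. card {a \<in> A. f a = b})"
    using card_UN_le[OF assms(2)] by metis
  also have "\<dots> \<le> (\<Sum>b\<in>B. n)" using assms(4) by (rule sum_mono)
  finally show ?thesis by (simp add: mult.commute)
qed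

lemma card_power_eq_le:
  fixes c :: "'a::idom"
  assumes "n > 0"
  shows "card {x. x ^ n = c} \<le> n"
proof -
  let ?p = "monom 1 n + [:- c:]"
  have "coeff ?p n = 1" using assms by (cases n) auto
  then have "?p \<noteq> 0" by (metis coeff_0 zero_neq_one)
  moreover have "degree ?p \<le> n"
    by (rule degree_add_le) (auto simp: degree_monom_le)
  moreover have "{x. x ^ n = c} = {x. poly ?p x = 0}"
    by (auto simp: poly_monom)
  ultimately show ?thesis using card_poly_roots_bound[of ?p] by simp
qed

lemma card_power_eq_self_le:
  assumes "n > 1"
  shows "card {x::'a::{idom,finite}. x ^ n = x} \<le> n"
proof -
  have "{x::'a. x ^ n = x} \<subseteq> insert 0 {x. x ^ (n - 1) = 1}"
    using assms by (cases n) auto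
  then have "card {x::'a. x ^ n = x} \<le> card (insert (0::'a) {x. x ^ (n - 1) = 1})"
    by (intro card_mono) auto
  also have "\<dots> \<le> Suc (card {x::'a. x ^ (n - 1) = 1})" by (rule card_insert_le_m1) auto
  also have "\<dots> \<le> n" using card_power_eq_le[of "n - 1" "1::'a"] assms by simp
  finally show ?thesis .
qed

text \<open>\<open>S\<close> lies in the root set, which has at most \<open>card S\<close> elements.
  Membership in a subfield thereby becomes an equation between powers.\<close>

lemma subfield_eq_roots:
  fixes S :: "'a::{field,finite} set"
  assumes S: "is_subfield S"
  shows "S = {x. x ^ card S = x}"
proof (rule card_subset_eq)
  show sub: "S \<subseteq> {x. x ^ card S = x}" using subfield_power_card[OF S] by auto
  have "{0, 1} \<subseteq> S" using S by (simp add: is_subfield_def)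
  then have "card {0, 1::'a} \<le> card S" by (intro card_mono) auto
  then have "card S > 1" by simp
  then show "card S = card {x::'a. x ^ card S = x}"
    using card_power_eq_self_le[of "card S", where ?'a = 'a] card_mono[OF _ sub] by simp
qed auto

text \<open>The trace is a polynomial of degree \<open>2 ^ (m - 1)\<close> in \<open>x\<close>. The
  bound serves for the absolute traces of both \<open>L\<close> and \<open>K\<close>, the latter
  with \<open>e\<close> for \<open>m\<close>.\<close>

lemma card_rel_trace_eq_le:
  fixes c :: "'a::idom"
  assumes "m > 0"
  shows "card {x. (\<Sum>i<m. x ^ (2 ^ i)) = c} \<le> 2 ^ (m - 1)"
proof -
  obtain n where n: "m = Suc n" using assms by (cases m) auto
  let ?p = "(\<Sum>i<m. monom 1 (2 ^ i)) + [:- c:]"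
  have "coeff ?p (2 ^ n) = (\<Sum>i<m. if i = n then 1 else 0)"
    unfolding coeff_add coeff_sum coeff_monom
    by (simp add: coeff_pCons split: nat.split)
  then have "coeff ?p (2 ^ n) = 1" by (simp add: n)
  then have "?p \<noteq> 0" by (metis coeff_0 zero_neq_one)
  moreover have "degree ?p \<le> 2 ^ n"
    by (intro degree_add_le degree_sum_le order.trans[OF degree_monom_le]) (auto simp: n)
  moreover have "{x. (\<Sum>i<m. x ^ (2 ^ i)) = c} = {x. poly ?p x = 0}"
    by (auto simp: poly_sum poly_monom)
  ultimately show ?thesis using card_poly_roots_bound[of ?p] by (simp add: n)
qed

section \<open>The field with q^2 elements in characteristic two: absolute trace, norm-one group,
  polar form\<close>

locale binary_quadratic_field =
  fixes m q :: nat and L :: "'a::{field,finite} set"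
  assumes m: "m \<ge> 2" and q: "q = 2 ^ m" and CARD_q: "CARD('a) = q\<^sup>2"
    and L_def: "L = {x. x ^ q = x}" and card_L: "card L = q"
begin

abbreviation H :: "'a set" where "H \<equiv> norm_one_group q"

text \<open>On \<open>L\<close> this is the absolute trace. Elsewhere it is merely the same additive
  polynomial, but the value 1 is taken only on \<open>L\<close>, see \<open>tr_1_L\<close>.\<close>

abbreviation tr :: "'a \<Rightarrow> 'a" where "tr \<equiv> rel_trace 2 m"

lemma q_ge: "q \<ge> 4"
  unfolding q using power_increasing[OF m, of "2::nat"] by simp

lemma power_CARD: "x ^ (q\<^sup>2) = (x::'a)"
  using subfield_power_card[of UNIV x] by (simp add: is_subfield_def CARD_q)

lemma power_qq: "(x ^ q) ^ q = (x::'a)"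
  using power_CARD[of x] by (simp add: power_mult power2_eq_square)

text \<open>The characteristic is read off from the cardinality: -1 equals its own power with
  exponent q^2, which is even.\<close>

lemma one_plus_one: "(1::'a) + 1 = 0"
proof -
  have "even (q\<^sup>2)" using q m by simp
  then have "(- 1 :: 'a) ^ (q\<^sup>2) = 1" by simp
  then have "(- 1 :: 'a) = 1" by (simp only: power_CARD)
  then show ?thesis by (metis add.right_inverse)
qed

lemma add_self [simp]: "x + x = (0::'a)"
  using one_plus_one by (metis distrib_left mult.right_neutral mult_zero_right)

lemma add_self_left [simp]: "x + (x + y) = (y::'a)"
  by (simp flip: add.assoc)

lemma uminus_eq [simp]: "- x = (x::'a)"
  by (metis add_self minus_unique)

lemma diff_eq_add [simp]: "x - y = x + (y::'a)"
  by (metis diff_conv_add_uminus uminus_eq)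

lemma two_eq_0 [simp]: "(2::'a) = 0"
  using one_plus_one by (metis one_add_one)

lemma eq_iff_add_eq_0: "x = y \<longleftrightarrow> x + y = (0::'a)"
  by (metis add_self add_self_left add.right_neutral)

lemma power2_add: "(x + y)\<^sup>2 = x\<^sup>2 + (y::'a)\<^sup>2"
  by (simp add: power2_sum)

lemma power_two_power_add: "(x + y) ^ (2 ^ n) = x ^ (2 ^ n) + (y::'a) ^ (2 ^ n)"
  by (induction n) (simp_all add: power_mult power2_add power_mult mult.commute[of 2])

lemma power_q_add: "(x + y) ^ q = x ^ q + (y::'a) ^ q"
  by (simp add: q power_two_power_add)

lemma power2_inj: "x\<^sup>2 = y\<^sup>2 \<longleftrightarrow> x = (y::'a)"
  using power2_add[of x y] by (metis add_self eq_iff_add_eq_0 zero_eq_power2)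

lemma tr_add: "tr (x + y) = tr x + tr y"
  by (simp add: rel_trace_def power_two_power_add sum.distrib)

lemma tr_0 [simp]: "tr 0 = 0"
  by (simp add: rel_trace_def power_0_left)

lemma tr_power2: "tr (x\<^sup>2) = (tr x)\<^sup>2"
proof -
  have "(\<Sum>i<n. x ^ (2 ^ i))\<^sup>2 = (\<Sum>i<n. (x ^ (2 ^ i))\<^sup>2)" for n
    by (induction n) (simp_all add: power2_add)
  then show ?thesis
    by (simp add: rel_trace_def mult.commute flip: power_mult)
qed

text \<open>The sum telescopes. It vanishes for \<open>x\<close> in \<open>L\<close>; outside
  \<open>L\<close> it produces the nonzero traces needed in \<open>H_tr\<close>.\<close>

lemma tr_artin_schreier: "tr (x + x\<^sup>2) = x + x ^ q"
proof -
  have "(\<Sum>i<n. (x + x\<^sup>2) ^ (2 ^ i)) = x + x ^ (2 ^ n)" for n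
    by (induction n)
       (simp_all add: power_two_power_add ac_simps flip: power_mult)
  then show ?thesis by (simp add: rel_trace_def q)
qed

lemma tr_L:
  assumes "x \<in> L"
  shows "tr x = 0 \<or> tr x = 1"
proof -
  have "tr x + (tr x)\<^sup>2 = 0"
    using tr_artin_schreier[of x] assms by (simp add: tr_add tr_power2 L_def)
  then have "tr x * (1 + tr x) = 0" by (simp add: algebra_simps power2_eq_square)
  then show ?thesis using eq_iff_add_eq_0 by auto
qed

lemma L_closed:
  assumes "x \<in> L" "y \<in> L"
  shows "x + y \<in> L" "x * y \<in> L" "x / y \<in> L" "x ^ n \<in> L"
proof -
  show "x + y \<in> L" "x * y \<in> L" "x / y \<in> L"
    using assms by (simp_all add: L_def power_q_add power_mult_distrib power_divide)
  have "(x ^ n) ^ q = (x ^ q) ^ n" by (simp add: mult.commute flip: power_mult)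
  then show "x ^ n \<in> L" using assms by (simp add: L_def)
qed

lemma L_01 [simp]: "0 \<in> L" "1 \<in> L"
  using q_ge by (auto simp: L_def)

lemma H_iff: "x \<in> H \<longleftrightarrow> x * x ^ q = 1"
  by (simp add: norm_one_group_def)

lemma H_power_q: "x \<in> H \<Longrightarrow> x \<noteq> 0 \<and> x ^ q = inverse x"
  unfolding H_iff by (metis inverse_unique mult_zero_left zero_neq_one)

lemma H_closed:
  assumes "x \<in> H" "y \<in> H"
  shows "x * y \<in> H" "inverse x \<in> H"
  using assms by (simp_all add: norm_one_group_def power_mult_distrib power_inverse
      del: power_Suc)

lemma H_1 [simp]: "1 \<in> H"
  by (simp add: norm_one_group_def)

text \<open>The q-th power is the identity on \<open>L\<close> and inversion on \<open>H\<close>, so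
  x^2 = 1, and squaring is injective.\<close>

lemma H_L: "x \<in> H \<Longrightarrow> x \<in> L \<Longrightarrow> x = 1"
  using power2_inj[of x 1] by (simp add: H_iff L_def power2_eq_square)

text \<open>The degree of the defining equation bounds \<open>card H\<close> above. For the lower
  bound, x -> x^(q-1) sends the q^2 - 1 nonzero elements into \<open>H\<close> with at most q - 1 in
  each fibre.\<close>

lemma card_H: "card H = q + 1"
proof (rule antisym)
  show "card H \<le> q + 1" unfolding norm_one_group_def by (rule card_power_eq_le) simp
  have pw: "(q - 1) * (q + 1) + 1 = q\<^sup>2"
    using q_ge by (simp add: algebra_simps power2_eq_square)
  have im: "(\<lambda>x. x ^ (q - 1)) ` (UNIV - {0}) \<subseteq> H"
  proof (rule image_subsetI)
    fix x :: 'a assume "x \<in> UNIV - {0}"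
    then have x: "x \<noteq> 0" by simp
    have "x ^ ((q - 1) * (q + 1)) * x = x"
      using power_CARD[of x] unfolding pw[symmetric] by (simp only: power_add power_one_right)
    then show "x ^ (q - 1) \<in> H"
      using x unfolding norm_one_group_def power_mult by simp
  qed
  have "card (UNIV - {0::'a}) \<le> (q - 1) * card H"
  proof (rule card_le_fibre_bound[OF _ _ im])
    fix b :: 'a
    have "card {a \<in> UNIV - {0}. a ^ (q - 1) = b} \<le> card {a. a ^ (q - 1) = b}"
      by (rule card_mono) auto
    also have "\<dots> \<le> q - 1" using q_ge by (intro card_power_eq_le) simp
    finally show "card {a \<in> UNIV - {0}. a ^ (q - 1) = b} \<le> q - 1" .
  qed auto
  moreover have "card (UNIV - {0::'a}) = (q - 1) * (q + 1)"
    unfolding card_Diff_singleton[OF UNIV_I] CARD_q pw[symmetric] by simp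
  ultimately have "(q - 1) * (q + 1) \<le> (q - 1) * card H" by (simp only:)
  then show "q + 1 \<le> card H" using q_ge by (simp only: mult_le_cancel1)
qed

text \<open>With u = 1 / (x + 1), the argument of the trace is u + u^2, and inverting x turns u into
  u + 1. Hence the trace is u + u^q = 1.\<close>

lemma H_tr:
  assumes "x \<in> H" "x \<noteq> 1"
  shows "tr (1 / (x + inverse x)) = 1" "x + inverse x \<noteq> 0"
proof -
  have x0: "x \<noteq> 0" "x ^ q = inverse x" using H_power_q assms by auto
  have x1: "x + 1 \<noteq> 0" using assms(2) eq_iff_add_eq_0 by blast
  let ?u = "1 / (x + 1)"
  have e: "x + inverse x = (x + 1)\<^sup>2 / x"
    using x0 by (simp add: power2_add field_simps power2_eq_square)
  then show "x + inverse x \<noteq> 0" using x0 x1 by simp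
  have "1 / (x + inverse x) = ?u + ?u\<^sup>2"
    unfolding e using x0 x1 by (simp add: divide_simps power2_eq_square add.assoc)
  then have "tr (1 / (x + inverse x)) = ?u + ?u ^ q" by (simp only: tr_artin_schreier)
  also have "?u ^ q = 1 / (inverse x + 1)" using x0 by (simp add: power_divide power_q_add)
  also have "\<dots> = x / (x + 1)" using x0 x1 by (simp add: field_simps)
  also have "?u + x / (x + 1) = 1" using x1 by (simp add: field_simps)
  finally show "tr (1 / (x + inverse x)) = 1" .
qed

lemma H_sum_L:
  assumes "x \<in> H"
  shows "x + inverse x \<in> L"
  using H_power_q[OF assms] by (simp add: L_def power_q_add power_inverse add.commute)

lemma card_tr_1_le: "card {y. tr y = 1} \<le> q div 2"
proof -
  have "q div 2 = 2 ^ (m - 1)" using m unfolding q by (cases m) auto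
  then show ?thesis using card_rel_trace_eq_le[of m "1::'a"] m by (simp add: rel_trace_def)
qed

text \<open>Counting gives surjectivity: \<open>?f\<close> identifies only x and its inverse, since
  both are the roots of one quadratic, so the q elements of \<open>H - {1}\<close> have at least q/2
  images. The polynomial bound allows at most q/2 elements of trace 1, so equality holds
  throughout.\<close>

lemma tr_1_image: "(\<lambda>x. 1 / (x + inverse x)) ` (H - {1}) = {y. tr y = 1}"
  and card_tr_1: "card {y. tr y = 1} = q div 2"
proof -
  let ?f = "\<lambda>x. 1 / (x + inverse x)" and ?T = "{y. tr y = 1}"
  have sub: "?f ` (H - {1}) \<subseteq> ?T" using H_tr by auto
  have "card (H - {1}) \<le> 2 * card (?f ` (H - {1}))"
  proof (rule card_le_fibre_bound)
    fix b assume "b \<in> ?f ` (H - {1})"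
    then obtain x where x: "x \<in> H" "x \<noteq> 1" "b = ?f x" by auto
    have "{a \<in> H - {1}. ?f a = b} \<subseteq> {x, inverse x}"
    proof
      fix y assume "y \<in> {a \<in> H - {1}. ?f a = b}"
      then have y: "y \<in> H" "y \<noteq> 1" "?f y = b" by auto
      then have "y + inverse y = x + inverse x" using x by simp
      moreover have "(y + x) * (y + inverse x) = y * y + y * (x + inverse x) + x * inverse x"
        by (simp add: algebra_simps)
      ultimately have "(y + x) * (y + inverse x) = y * y + y * (y + inverse y) + 1"
        using H_power_q[OF x(1)] by simp
      also have "\<dots> = 0" using H_power_q[OF y(1)] by (simp add: distrib_left)
      finally have "(y + x) * (y + inverse x) = 0" .
      then show "y \<in> {x, inverse x}" using eq_iff_add_eq_0 by auto
    qed
    then have "card {a \<in> H - {1}. ?f a = b} \<le> card {x, inverse x}" by (intro card_mono) auto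
    also have "\<dots> \<le> 2" by (simp add: card_insert_if)
    finally show "card {a \<in> H - {1}. ?f a = b} \<le> 2" .
  qed auto
  then have "q div 2 \<le> card (?f ` (H - {1}))" using card_H by simp
  moreover have "card (?f ` (H - {1})) \<le> card ?T" using sub by (intro card_mono) auto
  ultimately have "card (?f ` (H - {1})) = card ?T" "card ?T = q div 2"
    using card_tr_1_le by auto
  then show "?f ` (H - {1}) = ?T" "card ?T = q div 2"
    using sub by (simp_all add: card_subset_eq)
qed

lemma tr_1_obtain:
  assumes "tr y = 1"
  obtains x where "x \<in> H" "x + inverse x = 1 / y"
proof -
  from assms have "y \<in> (\<lambda>x. 1 / (x + inverse x)) ` (H - {1})" using tr_1_image by simp
  then obtain x where "x \<in> H" "y = 1 / (x + inverse x)" by blast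
  then show ?thesis using that[of x] by simp
qed

lemma tr_1_L:
  assumes "tr y = 1"
  shows "y \<in> L"
proof -
  obtain x where "x \<in> H" "x + inverse x = 1 / y" using tr_1_obtain assms by blast
  then have "y = 1 / (x + inverse x)" by simp
  then show ?thesis using H_sum_L[OF \<open>x \<in> H\<close>] L_closed(3) by simp
qed

text \<open>The norm N of z satisfies N^q = N, so \<open>N ^ (q div 2)\<close> is a square root of N
  in \<open>L\<close>. It has norm N as well, and dividing z by it leaves an element of
  \<open>H\<close>.\<close>

lemma polar:
  assumes "z \<noteq> 0"
  obtains r h where "r \<in> L" "h \<in> H" "z = r * h" "r\<^sup>2 = z ^ (q + 1)"
proof -
  define N where "N = z ^ (q + 1)"
  have NL: "N ^ q = N"
    unfolding N_def by (simp add: power_mult_distrib power_qq mult.commute)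
  define r where "r = N ^ (q div 2)"
  have "2 * (q div 2) = q" using q m by simp
  then have r2: "r\<^sup>2 = N"
    unfolding r_def by (metis NL mult.commute power_mult)
  have rL: "r \<in> L" unfolding r_def using NL by (intro L_closed) (auto simp: L_def)
  have r0: "r \<noteq> 0" using assms r2 N_def by auto
  have "r ^ (q + 1) = N" using rL r2 by (simp add: L_def power2_eq_square)
  then have "z / r \<in> H"
    using assms unfolding norm_one_group_def by (simp add: power_divide N_def)
  then show ?thesis using that[of r "z / r"] rL r0 r2 N_def by simp
qed

text \<open>
  For \<open>\<epsilon> = 1\<close>, failure would give two disjoint subsets of \<open>L - {0}\<close> with \<open>q / 2\<close> elements each.
  For \<open>\<epsilon> = 0\<close>, it would force \<open>tr w = tr (k / w)\<close> on all of \<open>L - {0}\<close>; as \<open>w ^ (q - 1) = 1\<close>, this is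
  a polynomial equation of degree at most \<open>q - 2\<close> with \<open>q - 1\<close> roots.
\<close>

lemma trace_pair_exists:
  assumes k: "k \<in> L" "k \<noteq> 0" and k4: "q = 4 \<Longrightarrow> k \<noteq> 1" and \<epsilon>: "\<epsilon> = 0 \<or> \<epsilon> = 1"
  obtains w where "w \<in> L" "w \<noteq> 0" "tr w = 1" "tr (k / w) = \<epsilon>"
proof -
  note witness = that
  let ?A = "{w. tr w = 1}" and ?B = "(\<lambda>w. k / w) ` {w. tr w = 1}"
  have A0: "w \<noteq> 0" "w \<in> L" if "w \<in> ?A" for w using that tr_1_L by auto
  have inj: "inj_on (\<lambda>w. k / w) ?A"
    using k A0 by (auto simp: inj_on_def divide_simps)
  have cB: "card ?B = q div 2" using card_image[OF inj] card_tr_1 by simp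
  have B_iff: "w \<in> ?B \<longleftrightarrow> tr (k / w) = 1" if "w \<noteq> 0" for w
    using that k by (auto simp: image_iff intro!: exI[of _ "k / w"])
  have BL: "?B \<subseteq> L - {0}" using k A0 L_closed by auto
  have q2: "q div 2 + q div 2 = q" using q m by (cases m) auto
  show ?thesis
  proof (rule ccontr)
    assume "\<not> thesis"
    then have no: "tr (k / w) \<noteq> \<epsilon>" if "w \<in> ?A" for w
      using witness[of w] A0[OF that] that by auto
    show False
    proof (cases "\<epsilon> = 1")
      case True
      then have "?A \<inter> ?B = {}" using no B_iff A0 by blast
      then have "card (?A \<union> ?B) = q" using q2 cB card_tr_1 by (simp add: card_Un_disjoint)
      moreover have "card (?A \<union> ?B) \<le> card (L - {0})" using A0 BL by (intro card_mono) auto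
      ultimately show False using card_L q_ge by (simp add: card_Diff_singleton)
    next
      case False
      have "?A \<subseteq> ?B"
      proof
        fix w assume w: "w \<in> ?A"
        then have "k / w \<in> L" using A0 k by (intro L_closed) auto
        then have "tr (k / w) = 1" using tr_L no[OF w] \<epsilon> False by auto
        then show "w \<in> ?B" using B_iff A0[OF w] by blast
      qed
      then have AB: "?A = ?B" using cB card_tr_1 by (intro card_subset_eq) auto
      have eq: "tr w + tr (k / w) = 0" if "w \<in> L" "w \<noteq> 0" for w
        using that AB B_iff[of w] tr_L[of w] tr_L[of "k / w"] k L_closed by auto
      define p where "p = (\<Sum>i<m. monom 1 (2 ^ i) + monom (k ^ (2 ^ i)) (q - 1 - 2 ^ i))"
      have le: "(2::nat) ^ i \<le> q div 2" if "i < m" for i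
      proof -
        have "(2::nat) ^ i \<le> 2 ^ (m - 1)" using that by (intro power_increasing) auto
        then show ?thesis using q m by (cases m) auto
      qed
      have poly_p: "poly p w = 0" if "w \<in> L - {0}" for w
      proof -
        have "w ^ (q - 1) * w = w" using that q_ge by (cases q) (auto simp: L_def mult.commute)
        then have w1: "w ^ (q - 1) = 1" using that by simp
        have "w ^ (q - 1 - 2 ^ i) = inverse w ^ (2 ^ i)" if "i < m" for i
        proof -
          have "q - 1 - 2 ^ i + 2 ^ i = q - 1" using le[OF that] q_ge by linarith
          then have "w ^ (q - 1 - 2 ^ i) * w ^ (2 ^ i) = 1" using w1 by (metis power_add)
          then show ?thesis by (metis inverse_unique mult.commute power_inverse)
        qed
        then have "poly p w = tr w + tr (k / w)"
          by (simp add: p_def poly_sum poly_monom rel_trace_def sum.distrib divide_inverse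
              power_mult_distrib)
        then show ?thesis using eq that by simp
      qed
      have coeff: "coeff p 1 = (\<Sum>i<m. if i = 0 then 1 else 0) +
          (\<Sum>i<m. if q - 1 - 2 ^ i = 1 then k ^ (2 ^ i) else 0)"
        unfolding p_def coeff_sum coeff_add coeff_monom sum.distrib
        by (intro arg_cong2[where f = "(+)"] sum.cong) auto
      \<comment> \<open>The first family contributes 1, from i = 0. The second reaches degree 1 only
        if 2^i = q - 2, that is for q = 4 and i = 1, where it adds k^2; this is why
        \<open>k4\<close> excludes k = 1.\<close>
      have "coeff p 1 \<noteq> 0"
      proof (cases "m = 2")
        case True
        have "coeff p 1 = 1 + k\<^sup>2"
          unfolding coeff using True q by (simp add: numeral_2_eq_2 lessThan_Suc)
        then show ?thesis using k4 True q power2_inj[of 1 k] eq_iff_add_eq_0[of 1 "k\<^sup>2"] by auto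
      next
        case False
        then have "q \<ge> 2 ^ 3" unfolding q using m by (intro power_increasing) auto
        then have "q \<ge> 8" by simp
        then have "q - 1 - 2 ^ i \<noteq> 1" if "i < m" for i using le[OF that] by linarith
        then have "(\<Sum>i<m. if q - 1 - 2 ^ i = 1 then k ^ (2 ^ i) else 0) = 0"
          by (intro sum.neutral) auto
        then show ?thesis unfolding coeff using m by simp
      qed
      then have p0: "p \<noteq> 0" by auto
      have "degree p \<le> q - 2"
        unfolding p_def
      proof (intro degree_sum_le degree_add_le order.trans[OF degree_monom_le])
        fix i assume "i \<in> {..<m}"
        then show "2 ^ i \<le> q - 2" using le[of i] q_ge by simp
        have "(1::nat) \<le> 2 ^ i" by simp
        then show "q - 1 - 2 ^ i \<le> q - 2" by linarith
      qed auto
      then have "card {w. poly p w = 0} \<le> q - 2"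
        using card_poly_roots_bound[OF p0] by simp
      moreover have "card (L - {0}) \<le> card {w. poly p w = 0}"
        using poly_p by (intro card_mono) auto
      ultimately show False using card_L q_ge by (simp add: card_Diff_singleton)
    qed
  qed
qed

section \<open>Sums of three elements of the norm-one group\<close>

lemma norm_L_add_H:
  assumes t: "t \<in> L" and x: "x \<in> H" and a: "a \<in> L"
  shows "(t + a * x) ^ (q + 1) = t\<^sup>2 + a\<^sup>2 + a * t * (x + inverse x)"
proof -
  have "(t + a * x) ^ q = t + a * inverse x"
    using t a H_power_q[OF x] by (simp add: L_def power_q_add power_mult_distrib)
  then have "(t + a * x) ^ (q + 1) = (t + a * x) * (t + a * inverse x)" by simp
  also have "\<dots> = t\<^sup>2 + a\<^sup>2 + a * t * (x + inverse x)"
    using H_power_q[OF x] by (simp add: algebra_simps power2_eq_square)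
  finally show ?thesis .
qed

text \<open>It suffices to find x in \<open>H\<close> such that t + x = r h in polar form with
  \<open>tr (1 / r) = 1\<close>: then r = y + 1/y for some y in \<open>H\<close>. If x + 1/x =
  1/\<tau>, the norm r^2 of t + x is c^2 w / \<tau> with w = \<tau> + t/c^2. The requirements on
  \<tau> and r become trace conditions on w and k/w.\<close>

lemma three_sum:
  assumes t: "t \<in> L" "t \<noteq> 0" "t \<noteq> 1"
  obtains x y z where "x \<in> H" "y \<in> H" "z \<in> H" "t = x + y + z"
proof -
  define c where "c = t + 1"
  have c: "c \<in> L" "c \<noteq> 0" using t eq_iff_add_eq_0 L_closed by (auto simp: c_def)
  \<comment> \<open>Chosen so that 1/r^2 = 1/c^2 + k/w below.\<close>
  define k where "k = t / c ^ 4"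
  have k: "k \<in> L" "k \<noteq> 0" using t c L_closed by (auto simp: k_def)
  have k4: "k \<noteq> 1" if "q = 4"
  proof
    assume "k = 1"
    then have "t = c ^ 4" using c by (simp add: k_def)
    also have "\<dots> = c" using c that by (simp add: L_def)
    finally show False by (simp add: c_def)
  qed
  have ic: "1 / c \<in> L" using c L_closed by auto
  \<comment> \<open>Prescribing this value for \<open>tr (k / w)\<close> cancels the contribution of
    1/c^2 and leaves trace 1 for 1/r^2.\<close>
  have "1 + tr (1 / c) = 0 \<or> 1 + tr (1 / c) = 1" using tr_L[OF ic] by auto
  from trace_pair_exists[OF k k4 this] obtain w where
    w: "w \<in> L" "w \<noteq> 0" "tr w = 1" "tr (k / w) = 1 + tr (1 / c)" by blast
  define \<tau> where "\<tau> = w + t / c\<^sup>2"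
  \<comment> \<open>As t = c + 1, this term has Artin-Schreier form, so \<tau> and w have the same
    trace.\<close>
  have "t / c\<^sup>2 = 1 / c + (1 / c)\<^sup>2"
    using c by (simp add: field_simps power2_eq_square) (simp add: c_def)
  then have "tr (t / c\<^sup>2) = 0" using ic by (simp only: tr_artin_schreier) (simp add: L_def)
  then have tr_\<tau>: "tr \<tau> = 1" using w by (simp add: \<tau>_def tr_add)
  then have \<tau>0: "\<tau> \<noteq> 0" by auto
  from tr_\<tau> obtain x where x: "x \<in> H" "x + inverse x = 1 / \<tau>" by (rule tr_1_obtain)
  have "(t + x) ^ (q + 1) = c\<^sup>2 + t / \<tau>"
    using norm_L_add_H[OF t(1) x(1), of 1] x by (simp add: c_def power2_add)
  also have "\<dots> = c\<^sup>2 * w / \<tau>"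
    using \<tau>0 c by (simp add: field_simps) (simp add: \<tau>_def field_simps)
  finally have N: "(t + x) ^ (q + 1) = c\<^sup>2 * w / \<tau>" .
  then have "t + x \<noteq> 0" using w c \<tau>0 by auto
  then obtain r h where rh: "r \<in> L" "h \<in> H" "t + x = r * h" "r\<^sup>2 = (t + x) ^ (q + 1)"
    by (rule polar)
  have "(1 / r)\<^sup>2 = \<tau> / (c\<^sup>2 * w)" using rh(4) unfolding N by (simp add: power_divide)
  also have "\<dots> = (1 / c)\<^sup>2 + k / w"
    using w c by (simp add: \<tau>_def k_def field_simps power4_eq_xxxx power2_eq_square)
  finally have "tr ((1 / r)\<^sup>2) = 1"
    using w tr_power2[of "1 / c"] tr_L[OF ic] by (auto simp: tr_add)
  then have "tr (1 / r) = 1" by (simp only: tr_power2) (metis one_power2 power2_inj)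
  then obtain y where y: "y \<in> H" "y + inverse y = 1 / (1 / r)" by (rule tr_1_obtain)
  have "t = x + (t + x)" by (simp add: ac_simps)
  also have "\<dots> = x + h * (y + inverse y)" using y rh by (simp add: mult.commute)
  finally have "t = x + h * y + h * inverse y" by (simp add: algebra_simps)
  then show ?thesis using that[of x "h * y" "h * inverse y"] x y rh H_closed by auto
qed

end

section \<open>The subfield \<open>K\<close>, the relative trace, and sums of two terms\<close>

locale binary_tower = binary_quadratic_field m q L
  for m q :: nat and L :: "'a::{field,finite} set" +
  fixes e s q0 :: nat and K :: "'a set"
  assumes e: "e \<ge> 1" and s: "s \<ge> 2" and q0: "q0 = 2 ^ e" and m_es: "m = s * e"
    and K_def: "K = {x. x ^ q0 = x}" and card_K: "card K = q0"
begin

abbreviation Tr :: "'a \<Rightarrow> 'a" where "Tr \<equiv> rel_trace q0 s"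

lemma q_q0: "q = q0 ^ s"
  by (simp add: q q0 m_es mult.commute flip: power_mult)

lemma q0_power: "q0 ^ i = 2 ^ (i * e)"
  by (simp add: q0 mult.commute flip: power_mult)

lemma q0_ge: "q0 \<ge> 2"
  unfolding q0 using power_increasing[OF e, of "2::nat"] by simp

lemma power_q0_add: "(x + y) ^ (q0 ^ i) = x ^ (q0 ^ i) + (y::'a) ^ (q0 ^ i)"
  by (simp add: q0_power power_two_power_add)

lemma Tr_add: "Tr (x + y) = Tr x + Tr y"
  by (simp add: rel_trace_def power_q0_add sum.distrib)

lemma sum_power_two_power: "(\<Sum>i\<in>A. f i) ^ (2 ^ n) = (\<Sum>i\<in>A. (f i :: 'a) ^ (2 ^ n))"
  if "finite A"
  using that by induction (simp_all add: power_two_power_add power_0_left)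

lemma K_power: "x \<in> K \<Longrightarrow> x ^ (q0 ^ i) = x"
  by (induction i) (simp_all add: K_def power_mult mult.commute[of q0])

lemma K_L: "K \<subseteq> L"
  using K_power[of _ s] by (auto simp: L_def q_q0)

lemma K_closed:
  assumes "x \<in> K" "y \<in> K"
  shows "x + y \<in> K" "x * y \<in> K" "x / y \<in> K"
  using assms power_q0_add[of x y 1] by (simp_all add: K_def power_mult_distrib power_divide)

lemma K_01 [simp]: "0 \<in> K" "1 \<in> K"
  using q0_ge by (auto simp: K_def)

lemma Tr_scale: "c \<in> K \<Longrightarrow> Tr (c * y) = c * Tr y"
  by (simp add: rel_trace_def power_mult_distrib K_power sum_distrib_left)

lemma Tr_power2: "Tr (x\<^sup>2) = (Tr x)\<^sup>2"
  using sum_power_two_power[of "{..<s}" "\<lambda>i. x ^ (q0 ^ i)" 1]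
  by (simp add: rel_trace_def mult.commute flip: power_mult)

text \<open>Raising to the power q0 permutes the summands cyclically, because y^(q0^s) = y on
  \<open>L\<close>.\<close>

lemma Tr_K:
  assumes "y \<in> L"
  shows "Tr y \<in> K"
proof -
  have "(Tr y) ^ q0 = (\<Sum>i<s. y ^ (q0 ^ Suc i))"
    using sum_power_two_power[of "{..<s}" "\<lambda>i. y ^ (q0 ^ i)" e]
    by (simp add: rel_trace_def mult.commute flip: power_mult q0)
  moreover have "y + (\<Sum>i<s. y ^ (q0 ^ Suc i)) = (\<Sum>i<Suc s. y ^ (q0 ^ i))"
    unfolding sum.lessThan_Suc_shift by simp
  moreover have "(\<Sum>i<Suc s. y ^ (q0 ^ i)) = y + Tr y"
    using assms by (simp add: rel_trace_def L_def q_q0 add.commute)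
  ultimately show ?thesis by (simp add: K_def)
qed

text \<open>Transitivity of the trace: the exponents below s * e are split into s blocks of length
  e.\<close>

lemma tr_Tr: "tr y = (\<Sum>j<e. (Tr y) ^ (2 ^ j))"
proof -
  have "tr y = (\<Sum>i<s. \<Sum>n\<in>{i * e..<i * e + e}. y ^ (2 ^ n))"
    unfolding rel_trace_def m_es by (rule sum.nat_group[symmetric])
  also have "\<dots> = (\<Sum>i<s. \<Sum>j<e. y ^ (2 ^ (i * e + j)))"
  proof (rule sum.cong[OF refl])
    fix i
    show "(\<Sum>n\<in>{i * e..<i * e + e}. y ^ (2 ^ n)) = (\<Sum>j<e. y ^ (2 ^ (i * e + j)))"
      using sum.shift_bounds_nat_ivl[of "\<lambda>n. y ^ (2 ^ n)" 0 "i * e" e]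
      by (simp add: add.commute lessThan_atLeast0)
  qed
  also have "\<dots> = (\<Sum>j<e. \<Sum>i<s. y ^ (2 ^ (i * e + j)))" by (rule sum.swap)
  also have "\<dots> = (\<Sum>j<e. (Tr y) ^ (2 ^ j))"
    by (simp add: rel_trace_def sum_power_two_power q0_power power_add power_mult)
  finally show ?thesis .
qed

text \<open>If \<open>Tr y\<close> were nonzero, the elements a * \<open>Tr y\<close> would exhaust
  \<open>K\<close>, so the absolute trace of \<open>K\<close> would vanish on all 2^e elements,
  beyond its degree 2^(e-1).\<close>

lemma Tr_eq_0_iff:
  assumes y: "y \<in> L"
  shows "Tr y = 0 \<longleftrightarrow> (\<forall>a\<in>K. tr (a * y) = 0)"
proof
  assume "Tr y = 0"
  then show "\<forall>a\<in>K. tr (a * y) = 0" by (simp add: tr_Tr Tr_scale power_0_left)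
next
  assume *: "\<forall>a\<in>K. tr (a * y) = 0"
  show "Tr y = 0"
  proof (rule ccontr)
    assume nz: "Tr y \<noteq> 0"
    have "x \<in> {x. (\<Sum>j<e. x ^ (2 ^ j)) = 0}" if x: "x \<in> K" for x
    proof -
      have aK: "x / Tr y \<in> K" using x Tr_K[OF y] K_closed by blast
      have "Tr (x / Tr y * y) = x" using Tr_scale[OF aK, of y] nz by simp
      then show ?thesis using *[rule_format, OF aK] by (simp add: tr_Tr)
    qed
    then have "card K \<le> card {x::'a. (\<Sum>j<e. x ^ (2 ^ j)) = 0}" by (intro card_mono) auto
    also have "\<dots> \<le> 2 ^ (e - 1)" using e by (intro card_rel_trace_eq_le) auto
    also have "\<dots> < 2 ^ e" using e by (intro power_strict_increasing) auto
    finally show False by (simp add: card_K q0)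
  qed
qed

text \<open>The norm of t + a x must be b^2, which means x + 1/x = (t + c)^2 / (a t) with c = a + b;
  an x in \<open>H\<close> other than 1 exists exactly when the reciprocal has trace 1. Conversely,
  an element of norm b^2 is b times an element of \<open>H\<close>, or 0 if b = 0.\<close>

lemma two_sum_iff:
  assumes t: "t \<in> L" "t \<notin> K"
  shows "(\<exists>a\<in>K. \<exists>b\<in>K. \<exists>x\<in>H. \<exists>y\<in>H. t = a * x + b * y) \<longleftrightarrow>
    (\<exists>a\<in>K. \<exists>c\<in>K. tr (a * (t / (t + c)\<^sup>2)) = 1)" (is "?l = ?r")
proof
  \<comment> \<open>This excludes the degenerate cases a = 0 and x = 1, in which t would lie in
    \<open>K\<close>.\<close>
  have monomial: "z \<in> K" if "z \<in> L" "z = b * y" "b \<in> K" "y \<in> H" for z b y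
  proof (cases "b = 0")
    case False
    then have "y = z / b" using that by simp
    then have "y \<in> L" using that K_L L_closed(3)[of z b] by auto
    then have "y = 1" using H_L that by blast
    then show ?thesis using that by simp
  qed (use that in auto)
  assume ?l
  then obtain a b x y where *: "a \<in> K" "b \<in> K" "x \<in> H" "y \<in> H" "t = a * x + b * y" by blast
  have t0: "t \<noteq> 0" using t by auto
  have a0: "a \<noteq> 0" using monomial[of t b y] * t by auto
  have bx: "t + a * x = b * y" unfolding *(5) by (simp add: ac_simps)
  have x1: "x \<noteq> 1"
  proof
    assume "x = 1"
    have "t + a \<in> L" using * t K_L by (intro L_closed) auto
    then have "t + a \<in> K" using monomial[of "t + a" b y] bx * \<open>x = 1\<close> by simp
    then have "(t + a) + a \<in> K" using *(1) by (rule K_closed(1))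
    then show False using t by (simp add: add.assoc)
  qed
  have tc: "t + (a + b) \<noteq> 0" using t K_closed(1)[OF *(1,2)] eq_iff_add_eq_0[of t "a + b"] by auto
  have "(b * y) ^ (q + 1) = b\<^sup>2"
    using * K_L H_iff[of y]
    by (auto simp: power_mult_distrib L_def power2_eq_square algebra_simps subset_eq)
  then have "b\<^sup>2 = t\<^sup>2 + a\<^sup>2 + a * t * (x + inverse x)"
    using norm_L_add_H[OF t(1) *(3), of a] * K_L unfolding bx by auto
  then have "a * t * (x + inverse x) = t\<^sup>2 + a\<^sup>2 + b\<^sup>2" by (simp add: ac_simps)
  then have "x + inverse x = (t + (a + b))\<^sup>2 / (a * t)"
    using a0 t0 by (simp add: power2_add field_simps)
  then have "1 / (x + inverse x) = a * (t / (t + (a + b))\<^sup>2)" by simp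
  then show ?r using H_tr(1)[OF *(3) x1] * K_closed by metis
next
  assume ?r
  then obtain a c where ac: "a \<in> K" "c \<in> K" and tr: "tr (a * (t / (t + c)\<^sup>2)) = 1" by blast
  have a0: "a \<noteq> 0" using tr by auto
  have t0: "t \<noteq> 0" using t by auto
  from tr obtain x where x: "x \<in> H" "x + inverse x = 1 / (a * (t / (t + c)\<^sup>2))"
    by (rule tr_1_obtain)
  define b where "b = a + c"
  have b: "b \<in> K" using ac K_closed by (simp add: b_def)
  have "(t + a * x) ^ (q + 1) = t\<^sup>2 + a\<^sup>2 + a * t * (x + inverse x)"
    using norm_L_add_H[OF t(1) x(1)] ac K_L by blast
  also have "\<dots> = t\<^sup>2 + a\<^sup>2 + (t + c)\<^sup>2" using x a0 t0 by simp
  also have "\<dots> = b\<^sup>2" by (simp add: b_def power2_add ac_simps)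
  finally have N: "(t + a * x) ^ (q + 1) = b\<^sup>2" .
  have t_eq: "t = a * x + (t + a * x)" by (simp add: ac_simps)
  show ?l
  proof (cases "b = 0")
    case True
    then have "t = a * x + 0 * 1" using N eq_iff_add_eq_0[of t "a * x"] by auto
    then show ?thesis using ac x H_1 K_01 by blast
  next
    case False
    have "b ^ (q + 1) = b\<^sup>2" using b K_L by (auto simp: L_def power2_eq_square)
    then have "(t + a * x) / b \<in> H"
      using N False unfolding norm_one_group_def by (simp add: power_divide del: power_Suc)
    moreover have "t = a * x + b * ((t + a * x) / b)" using False t_eq by simp
    ultimately show ?thesis using ac b x by blast
  qed
qed

text \<open>
  The characterisation in \<open>two_sum_iff\<close> is turned into the conditions on \<open>\<alpha> = 1 / t\<close> by the
  Artin--Schreier identity \<open>g + g\<^sup>2 = c * t / (t + c)\<^sup>2\<close>, where \<open>g = t / (t + c) = 1 / (1 + c / t)\<close>.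
\<close>

lemma not_two_sum_iff:
  assumes t: "t \<in> L" "t \<notin> K"
  shows "\<not> (\<exists>a\<in>K. \<exists>b\<in>K. \<exists>x\<in>H. \<exists>y\<in>H. t = a * x + b * y) \<longleftrightarrow>
    Tr (1 / t) = 0 \<and> (\<forall>c\<in>K - {0}. Tr (1 / (1 + c * (1 / t))) \<in> {0, 1})"
proof -
  have t0: "t \<noteq> 0" using t by auto
  have L: "t / (t + c)\<^sup>2 \<in> L" if "c \<in> K" for c
    using t that K_L by (intro L_closed) auto
  have tr01: "tr (a * (t / (t + c)\<^sup>2)) = 0 \<or> tr (a * (t / (t + c)\<^sup>2)) = 1"
    if "a \<in> K" "c \<in> K" for a c
    using that K_L L by (intro tr_L L_closed(2)) auto
  have "\<not> (\<exists>a\<in>K. \<exists>b\<in>K. \<exists>x\<in>H. \<exists>y\<in>H. t = a * x + b * y) \<longleftrightarrow>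
      (\<forall>c\<in>K. \<forall>a\<in>K. tr (a * (t / (t + c)\<^sup>2)) = 0)"
    unfolding two_sum_iff[OF t] using tr01 by (metis zero_neq_one)
  also have "\<dots> \<longleftrightarrow> (\<forall>c\<in>K. Tr (t / (t + c)\<^sup>2) = 0)"
    using Tr_eq_0_iff[OF L] by simp
  \<comment> \<open>The case c = 0 is split off: it gives the condition on
    \<open>Tr (1 / t)\<close>, whereas the Artin-Schreier argument has to divide by c.\<close>
  also have "\<dots> \<longleftrightarrow> Tr (t / (t + 0)\<^sup>2) = 0 \<and> (\<forall>c\<in>K - {0}. Tr (t / (t + c)\<^sup>2) = 0)"
    using K_01 by blast
  also have "t / (t + 0)\<^sup>2 = 1 / t" using t0 by (simp add: power2_eq_square)
  also have "(\<forall>c\<in>K - {0}. Tr (t / (t + c)\<^sup>2) = 0) \<longleftrightarrow>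
      (\<forall>c\<in>K - {0}. Tr (1 / (1 + c * (1 / t))) \<in> {0, 1})"
  proof (rule ball_cong[OF refl])
    fix c assume c: "c \<in> K - {0}"
    let ?g = "1 / (1 + c * (1 / t))"
    have tc: "t + c \<noteq> 0" using c t eq_iff_add_eq_0 by auto
    have g: "?g = t / (t + c)" using t0 tc by (simp add: divide_simps)
    have "t / (t + c) = t * (t + c) / (t + c)\<^sup>2" using tc by (simp add: power2_eq_square)
    then have "?g + ?g\<^sup>2 = (t * (t + c) + t\<^sup>2) / (t + c)\<^sup>2"
      unfolding g power_divide add_divide_distrib by simp
    also have "t * (t + c) + t\<^sup>2 = c * t" by (simp add: algebra_simps power2_eq_square)
    finally have "c * (t / (t + c)\<^sup>2) = ?g + ?g\<^sup>2" by simp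
    then have "c * Tr (t / (t + c)\<^sup>2) = Tr ?g + (Tr ?g)\<^sup>2"
      using c Tr_scale[of c "t / (t + c)\<^sup>2"] by (simp only: Tr_add Tr_power2) simp
    also have "\<dots> = Tr ?g * (Tr ?g + 1)" by (simp add: algebra_simps power2_eq_square)
    finally show "Tr (t / (t + c)\<^sup>2) = 0 \<longleftrightarrow> Tr ?g \<in> {0, 1}"
      using c eq_iff_add_eq_0[of "Tr ?g" 1] by (auto simp del: mult_cancel_left)
  qed
  finally show ?thesis .
qed

end

section \<open>Covering radius through syndromes\<close>

primrec combinations :: "'a::field set \<Rightarrow> 'a set \<Rightarrow> nat \<Rightarrow> 'a set" where
  "combinations K I 0 = {0}"
| "combinations K I (Suc n) = {z + a * x |z a x. z \<in> combinations K I n \<and> a \<in> K \<and> x \<in> I}"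

text \<open>Repeated elements of \<open>I\<close> and zero coefficients are allowed in
  \<open>combinations\<close>; repetitions merge into one coordinate, so n terms amount to the
  syndrome of a word of weight at most n.\<close>

lemma combinations_iff:
  fixes K I :: "'a::field set"
  assumes K: "is_subfield K" and I: "finite I" "I \<noteq> {}"
  shows "z \<in> combinations K I n \<longleftrightarrow>
    (\<exists>f\<in>I \<rightarrow>\<^sub>E K. card {i \<in> I. f i \<noteq> 0} \<le> n \<and> (\<Sum>x\<in>I. f x * x) = z)"
proof (induction n arbitrary: z)
  case 0
  have 0: "(\<Sum>x\<in>I. f x * x) = 0" if "card {i \<in> I. f i \<noteq> 0} \<le> 0" for f :: "'a \<Rightarrow> 'a"
  proof (rule sum.neutral, rule ballI)
    fix x assume "x \<in> I"
    moreover have "finite {i \<in> I. f i \<noteq> 0}" using I by simp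
    then have "{i \<in> I. f i \<noteq> 0} = {}" using that by (metis card_0_eq le_zero_eq)
    ultimately have "f x = 0" by blast
    then show "f x * x = 0" by simp
  qed
  have f: "(\<lambda>x\<in>I. 0) \<in> I \<rightarrow>\<^sub>E K" using K by (simp add: is_subfield_def)
  have "{i \<in> I. (\<lambda>x\<in>I. 0::'a) i \<noteq> 0} = {}" by simp
  then have c: "card {i \<in> I. (\<lambda>x\<in>I. 0::'a) i \<noteq> 0} \<le> 0" by (simp only: card.empty)
  show ?case
    unfolding combinations.simps singleton_iff using 0 0[OF c] f c by blast
next
  case (Suc n)
  have upd: "(\<Sum>y\<in>I. (f(x := f x + a)) y * y) = (\<Sum>y\<in>I. f y * y) + a * x"
    if "x \<in> I" for f :: "'a \<Rightarrow> 'a" and a x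
  proof -
    have "(\<Sum>y\<in>I - {x}. (f(x := f x + a)) y * y) = (\<Sum>y\<in>I - {x}. f y * y)"
      by (rule sum.cong) auto
    then show ?thesis
      using sum.remove[OF I(1) that, of "\<lambda>y. (f(x := f x + a)) y * y"]
        sum.remove[OF I(1) that, of "\<lambda>y. f y * y"] by (simp add: distrib_right)
  qed
  have updK: "f(x := f x + a) \<in> I \<rightarrow>\<^sub>E K" if "f \<in> I \<rightarrow>\<^sub>E K" "x \<in> I" "a \<in> K" for f a x
    using that K by (auto simp: is_subfield_def PiE_iff extensional_def)
  show ?case
  proof
    assume "z \<in> combinations K I (Suc n)"
    then obtain z' a x where z: "z = z' + a * x" "z' \<in> combinations K I n" "a \<in> K" "x \<in> I"
      by auto
    then obtain f where f: "f \<in> I \<rightarrow>\<^sub>E K" "card {i \<in> I. f i \<noteq> 0} \<le> n" "(\<Sum>x\<in>I. f x * x) = z'"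
      using Suc.IH by blast
    have "card {i \<in> I. (f(x := f x + a)) i \<noteq> 0} \<le> card (insert x {i \<in> I. f i \<noteq> 0})"
      using I by (intro card_mono) auto
    also have "\<dots> \<le> Suc n" using f I by (simp add: card_insert_if)
    finally show "\<exists>f\<in>I \<rightarrow>\<^sub>E K. card {i \<in> I. f i \<noteq> 0} \<le> Suc n \<and> (\<Sum>x\<in>I. f x * x) = z"
      using upd[OF z(4), of f a] updK[OF f(1) z(4) z(3)] f z by blast
  next
    assume "\<exists>f\<in>I \<rightarrow>\<^sub>E K. card {i \<in> I. f i \<noteq> 0} \<le> Suc n \<and> (\<Sum>x\<in>I. f x * x) = z"
    then obtain f where f: "f \<in> I \<rightarrow>\<^sub>E K" "card {i \<in> I. f i \<noteq> 0} \<le> Suc n"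
      "(\<Sum>x\<in>I. f x * x) = z" by blast
    \<comment> \<open>An element of the support, to be split off as the last term; if the support is
      empty, any x serves, with coefficient 0.\<close>
    obtain x where x: "x \<in> I" "card ({i \<in> I. f i \<noteq> 0} - {x}) \<le> n"
    proof (cases "{i \<in> I. f i \<noteq> 0} = {}")
      case True
      then show ?thesis using I that by (metis card.empty empty_Diff equals0I zero_le)
    next
      case False
      then obtain x where "x \<in> {i \<in> I. f i \<noteq> 0}" by blast
      then show ?thesis using that[of x] f I by (simp add: card_Diff_singleton)
    qed
    let ?g = "f(x := f x + - f x)"
    have fK: "f x \<in> K" "- f x \<in> K" using f x K by (auto simp: is_subfield_def)
    have "{i \<in> I. ?g i \<noteq> 0} = {i \<in> I. f i \<noteq> 0} - {x}" by auto
    then have "card {i \<in> I. ?g i \<noteq> 0} \<le> n" using x by simp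
    moreover have "?g \<in> I \<rightarrow>\<^sub>E K" using updK f x fK by blast
    ultimately have "(\<Sum>y\<in>I. ?g y * y) \<in> combinations K I n" using Suc.IH by blast
    moreover have "z = (\<Sum>y\<in>I. ?g y * y) + f x * x"
      unfolding upd[OF x(1)] using f by simp
    ultimately show "z \<in> combinations K I (Suc n)" using x fK by auto
  qed
qed

text \<open>A word is within distance n of the code iff some word of weight at most n has the same
  syndrome, their difference being a codeword.\<close>

lemma covering_radius_le_iff:
  fixes K :: "'a::{field,finite} set"
  assumes K: "is_subfield K" and all: "combinations K (norm_one_group q) N = UNIV"
  shows "covering_radius (norm_one_group q) K (code_C K q) \<le> n \<longleftrightarrow>
    combinations K (norm_one_group q) n = UNIV"
proof -
  let ?H = "norm_one_group q :: 'a set" and ?C = "code_C K q"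
  have fin: "finite ?H" "?H \<noteq> {}"
    by (auto simp: norm_one_group_def intro!: exI[of _ 1])
  note comb = combinations_iff[OF K fin]
  have finV: "finite (?H \<rightarrow>\<^sub>E K)" by (intro finite_PiE) auto
  have finC: "finite ?C" using finV by (rule rev_finite_subset) (auto simp: code_C_def)
  have K_diff: "x - y \<in> K" if "x \<in> K" "y \<in> K" for x y
    using K that unfolding is_subfield_def by (auto simp flip: add_uminus_conv_diff)
  have 0: "0 \<in> K" using K by (simp add: is_subfield_def)
  then have zeroC: "(\<lambda>x\<in>?H. 0) \<in> ?C" by (auto simp: code_C_def)
  have dist: "(\<exists>c\<in>?C. hamming_dist ?H v c \<le> n) \<longleftrightarrow> (\<Sum>x\<in>?H. v x * x) \<in> combinations K ?H n"
    if v: "v \<in> ?H \<rightarrow>\<^sub>E K" for v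
  proof
    assume "\<exists>c\<in>?C. hamming_dist ?H v c \<le> n"
    then obtain c where c: "c \<in> ?H \<rightarrow>\<^sub>E K" "(\<Sum>x\<in>?H. c x * x) = 0" "hamming_dist ?H v c \<le> n"
      by (auto simp: code_C_def)
    let ?f = "\<lambda>x\<in>?H. v x - c x"
    have "?f \<in> ?H \<rightarrow>\<^sub>E K" using v c by (auto intro!: K_diff)
    moreover have "{i \<in> ?H. ?f i \<noteq> 0} = {i \<in> ?H. v i \<noteq> c i}" by auto
    moreover have "(\<Sum>x\<in>?H. ?f x * x) = (\<Sum>x\<in>?H. v x * x)"
      using c by (simp add: left_diff_distrib sum_subtractf)
    ultimately show "(\<Sum>x\<in>?H. v x * x) \<in> combinations K ?H n"
      unfolding comb using c(3) by (intro bexI[of _ ?f]) (simp_all only: hamming_dist_def simp_thms)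
  next
    assume "(\<Sum>x\<in>?H. v x * x) \<in> combinations K ?H n"
    then obtain f where f: "f \<in> ?H \<rightarrow>\<^sub>E K" "card {i \<in> ?H. f i \<noteq> 0} \<le> n"
      "(\<Sum>x\<in>?H. f x * x) = (\<Sum>x\<in>?H. v x * x)" unfolding comb by blast
    let ?c = "\<lambda>x\<in>?H. v x - f x"
    have "?c \<in> ?H \<rightarrow>\<^sub>E K" using v f by (auto intro!: K_diff)
    moreover have "(\<Sum>x\<in>?H. ?c x * x) = 0"
      using f by (simp add: left_diff_distrib sum_subtractf)
    moreover have "{i \<in> ?H. v i \<noteq> ?c i} = {i \<in> ?H. f i \<noteq> 0}" by auto
    ultimately show "\<exists>c\<in>?C. hamming_dist ?H v c \<le> n"
      using f by (intro bexI[of _ ?c]) (simp_all add: hamming_dist_def code_C_def)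
  qed
  have "covering_radius ?H K ?C \<le> n \<longleftrightarrow>
      (\<forall>v\<in>?H \<rightarrow>\<^sub>E K. (MIN c\<in>?C. hamming_dist ?H v c) \<le> n)"
    unfolding covering_radius_def using finV 0 by (subst Max_le_iff) (auto simp: PiE_eq_empty_iff)
  also have "\<dots> \<longleftrightarrow> (\<forall>v\<in>?H \<rightarrow>\<^sub>E K. \<exists>c\<in>?C. hamming_dist ?H v c \<le> n)"
    using finC zeroC by (intro ball_cong refl, subst Min_le_iff) auto
  also have "\<dots> \<longleftrightarrow> (\<forall>v\<in>?H \<rightarrow>\<^sub>E K. (\<Sum>x\<in>?H. v x * x) \<in> combinations K ?H n)"
    using dist by simp
  also have "\<dots> \<longleftrightarrow> combinations K ?H n = UNIV"
  proof
    \<comment> \<open>By \<open>all\<close>, every field element is the syndrome of some word, so a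
      statement about words covers the whole field.\<close>
    assume *: "\<forall>v\<in>?H \<rightarrow>\<^sub>E K. (\<Sum>x\<in>?H. v x * x) \<in> combinations K ?H n"
    have "z \<in> combinations K ?H n" for z
    proof -
      have "z \<in> combinations K ?H N" using all by simp
      then show ?thesis unfolding comb[of z N] using * by blast
    qed
    then show "combinations K ?H n = UNIV" by blast
  qed simp
  finally show ?thesis .
qed

section \<open>Which field elements are combinations of one, two or three terms\<close>

context binary_tower
begin

text \<open>\<open>H\<close> is a group, so the second polar factor can be absorbed into the
  terms.\<close>

lemma combinations_scale:
  assumes "h \<in> H" "z \<in> combinations K H n"
  shows "z * h \<in> combinations K H n"
  using assms(2)
proof (induction n arbitrary: z)
  case (Suc n)
  then obtain z' a x where "z = z' + a * x" "z' \<in> combinations K H n" "a \<in> K" "x \<in> H" by auto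
  then have "z * h = z' * h + a * (x * h)" "z' * h \<in> combinations K H n" "x * h \<in> H" "a \<in> K"
    using Suc.IH H_closed(1)[OF _ assms(1)] by (simp_all add: distrib_right mult.assoc)
  then show ?case by auto
qed simp

lemma combinations_mono: "combinations K H n \<subseteq> combinations K H (Suc n)"
proof
  fix z assume "z \<in> combinations K H n"
  then have "z + 0 * 1 \<in> combinations K H (Suc n)" using K_01 H_1 unfolding combinations.simps by blast
  then show "z \<in> combinations K H (Suc n)" by simp
qed

lemma combinations_1_iff: "z \<in> combinations K H 1 \<longleftrightarrow> (\<exists>a\<in>K. \<exists>x\<in>H. z = a * x)"
  by auto

lemma combinations_2_iff:
  "z \<in> combinations K H 2 \<longleftrightarrow> (\<exists>a\<in>K. \<exists>b\<in>K. \<exists>x\<in>H. \<exists>y\<in>H. z = a * x + b * y)"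
  by (auto simp: numeral_2_eq_2) blast+

lemma K_combinations_1: "z \<in> K \<Longrightarrow> z \<in> combinations K H 1"
  unfolding combinations_1_iff using H_1 by force

lemma combinations_UNIV:
  assumes "n \<ge> 1" "L - K \<subseteq> combinations K H n"
  shows "combinations K H n = UNIV"
proof -
  have K: "K \<subseteq> combinations K H n"
    using assms(1)
  proof (induction rule: dec_induct)
    case base
    show ?case using K_combinations_1 by blast
  next
    case (step i)
    then show ?case using combinations_mono by blast
  qed
  have "z \<in> combinations K H n" for z
  proof (cases "z = 0")
    case False
    then obtain r h where "r \<in> L" "h \<in> H" "z = r * h" by (rule polar)
    then show ?thesis using combinations_scale assms(2) K by blast
  qed (use K in auto)
  then show ?thesis by blast
qed

lemma combinations_3_UNIV: "combinations K H 3 = UNIV"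
proof (rule combinations_UNIV)
  show "L - K \<subseteq> combinations K H 3"
  proof
    fix t assume t: "t \<in> L - K"
    then have "t \<noteq> 0" "t \<noteq> 1" by auto
    with t obtain x y z where xyz: "x \<in> H" "y \<in> H" "z \<in> H" "t = x + y + z"
      using three_sum by blast
    have "x + y = 1 * x + 1 * y" by simp
    then have "x + y \<in> combinations K H 2"
      unfolding combinations_2_iff using K_01(2) xyz by blast
    then have "(x + y) + 1 * z \<in> combinations K H (Suc 2)"
      unfolding combinations.simps(2) using K_01(2) xyz by blast
    moreover have "Suc 2 = 3" by simp
    ultimately show "t \<in> combinations K H 3" using xyz by (simp only: mult_1)
  qed
qed simp

lemma L_K_nonempty: "L - K \<noteq> {}"
proof
  assume "L - K = {}"
  then have "card L \<le> card K" by (intro card_mono) auto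
  then have "q0 ^ s \<le> q0 ^ 1" by (simp add: card_L card_K q_q0)
  then show False using power_strict_increasing[of 1 s q0] s q0_ge by simp
qed

text \<open>If t in \<open>L - K\<close> were a x, then x = t/a would lie in both \<open>L\<close>
  and \<open>H\<close>, forcing x = 1 and t in \<open>K\<close>.\<close>

lemma combinations_1_not_UNIV: "combinations K H 1 \<noteq> UNIV"
proof
  assume *: "combinations K H 1 = UNIV"
  obtain t where t: "t \<in> L" "t \<notin> K" using L_K_nonempty by blast
  obtain a x where ax: "a \<in> K" "x \<in> H" "t = a * x" using * combinations_1_iff[of t] by blast
  then have "a \<noteq> 0" "x = t / a" using t by auto
  then have "x \<in> L" using t ax K_L L_closed(3)[of t a] by auto
  then show False using H_L[OF ax(2)] ax t by simp
qed

text \<open>Inversion permutes \<open>L - K\<close>, so the condition on 1/t for some t is the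
  condition on some \<alpha>.\<close>

lemma combinations_2_UNIV_iff:
  "combinations K H 2 = UNIV \<longleftrightarrow> \<not> (\<exists>\<alpha>\<in>L - K. Tr \<alpha> = 0 \<and>
     (\<forall>b\<in>K - {0}. Tr (1 / (1 + b * \<alpha>)) \<in> {0, 1}))" (is "_ \<longleftrightarrow> \<not> (\<exists>\<alpha>\<in>L - K. ?good \<alpha>)")
proof -
  have inv: "1 / t \<in> L - K" if "t \<in> L - K" for t
  proof -
    have "1 / t \<in> L" using that L_closed by auto
    moreover have "1 / t \<notin> K" using that K_closed(3)[of 1 "1 / t"] by auto
    ultimately show ?thesis by simp
  qed
  have bad: "t \<notin> combinations K H 2 \<longleftrightarrow> ?good (1 / t)" if "t \<in> L - K" for t
    unfolding combinations_2_iff using not_two_sum_iff[of t] that by blast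
  have "combinations K H 2 = UNIV \<longleftrightarrow> (\<forall>t\<in>L - K. t \<in> combinations K H 2)"
    using combinations_UNIV[of 2] by auto
  also have "\<dots> \<longleftrightarrow> (\<forall>t\<in>L - K. \<not> ?good (1 / t))" using bad by blast
  also have "\<dots> \<longleftrightarrow> \<not> (\<exists>\<alpha>\<in>L - K. ?good \<alpha>)"
  proof -
    have "?good (1 / (1 / \<alpha>))" if "?good \<alpha>" for \<alpha>
      unfolding divide_divide_eq_right mult_1 div_by_1 using that .
    then show ?thesis using inv by blast
  qed
  finally show ?thesis .
qed

end

theorem mainTheorem2:
  fixes q0 s q :: nat
    and K L :: "'a::{field,finite} set"
  assumes "primepow q0" and "q0 \<ge> 2" and "even q0"
    and "s \<ge> 2"
    and "q = q0 ^ s"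
    and "CARD('a) = q ^ 2"
    and "is_subfield K" and "card K = q0"
    and "is_subfield L" and "card L = q"
  defines "\<rho> \<equiv> covering_radius (norm_one_group q) K (code_C K q)"
    and "good \<equiv> \<lambda>\<alpha>. rel_trace q0 s \<alpha> = 0 \<and>
           (\<forall>b\<in>K - {0}. rel_trace q0 s (1 / (1 + b * \<alpha>)) \<in> {0, 1})"
  shows "(\<rho> = 3 \<longleftrightarrow> (\<exists>\<alpha>\<in>L - K. good \<alpha>)) \<and> (\<not> (\<exists>\<alpha>\<in>L - K. good \<alpha>) \<longrightarrow> \<rho> = 2)"
proof -
  obtain p e where pe: "prime p" "e > 0" "q0 = p ^ e"
    using \<open>primepow q0\<close> by (auto simp: primepow_def)
  then have "even p" using \<open>even q0\<close> by simp
  then have p: "p = 2" using \<open>prime p\<close> primes_dvd_imp_eq two_is_prime_nat by blast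
  have "2 * 1 \<le> s * e" using \<open>s \<ge> 2\<close> pe by (intro mult_mono) auto
  then interpret binary_tower "s * e" q L e s q0 K
    using assms pe p subfield_eq_roots[OF \<open>is_subfield K\<close>] subfield_eq_roots[OF \<open>is_subfield L\<close>]
    by unfold_locales (simp_all add: mult.commute flip: power_mult)
  note le = covering_radius_le_iff[OF \<open>is_subfield K\<close> combinations_3_UNIV]
  \<comment> \<open>Only the values 2 and 3 remain, and two-term combinations decide between
    them.\<close>
  have "\<rho> \<le> 3" "\<not> \<rho> \<le> 1"
    unfolding \<rho>_def le using combinations_3_UNIV combinations_1_not_UNIV by blast+
  moreover have "\<rho> \<le> 2 \<longleftrightarrow> \<not> (\<exists>\<alpha>\<in>L - K. good \<alpha>)"
    unfolding \<rho>_def le good_def by (rule combinations_2_UNIV_iff)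
  ultimately show ?thesis by linarith
qed

end
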